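(* Let $K$ be an infinite field of characteristic $2$, and let $$\begin{aligned} f(x_1,x_2,x_3,x_4,x_5)={}&[x_5,x_4][x_2,x_1,x_3]+[x_3,x_1,x_2][x_5,x_4]+[x_4,x_1,x_3][x_5,x_2]\\&+[x_3,x_1][x_4,x_2,x_5]+[x_4,x_3][x_5,x_1,x_2]+[x_5,x_3,x_4][x_2,x_1],\end{aligned}$$ $$\mathfrak{S}(x_1,x_2,x_3,x_4,x_5)=[[x_1,x_2][x_3,x_5],x_4]+[[x_1,x_3][x_4,x_5],x_2]+[[x_1,x_4][x_2,x_5],x_3],$$ $$\mathfrak{T}(x_1,x_2,x_3,x_4,x_5)=[[x_1,x_2],x_3][x_4,x_5]+[[x_1,x_2],x_4][x_5,x_3]+[[x_1,x_2],x_5][x_3,x_4]$$ in $K\langle X\rangle$. Then $f\in\langle\mathfrak{S}\rangle^{\mathrm{T}}$. Moreover, $\langle f,\mathfrak{T}\rangle^{\mathrm{T}}=\langle\mathfrak{S},\mathfrak{T}\rangle^{\mathrm{T}}$.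
   Context: $K\langle X\rangle$ is the free associative $K$-algebra on $X=\{x_1,x_2,\ldots\}$. Commutators: $[u,v]=uv-vu$, and longer commutators are left-normed, $[u_1,\ldots,u_n]=[[u_1,\ldots,u_{n-1}],u_n]$. A T-ideal of $K\langle X\rangle$ is a two-sided ideal $I$ with $\phi(I)\subseteq I$ for every endomorphism $\phi$ of $K\langle X\rangle$; $\langle f_1,\ldots,f_k\rangle^{\mathrm{T}}$ is the smallest T-ideal containing $f_1,\ldots,f_k$. *)

theory Defs
  imports "HOL-Library.Poly_Mapping" "HOL.Hull"
begin

text \<open>
  The free monoid on countably many letters, written additively so that the monoid algebra of
  \<open>Poly_Mapping\<close> (finitely supported functions with the convolution product) applies;
  addition of words is concatenation and is not commutative.
\<close>

datatype fword = FWord (letters: "nat list")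

instantiation fword :: monoid_add
begin

definition zero_fword :: fword
  where "0 = FWord []"

definition plus_fword :: "fword \<Rightarrow> fword \<Rightarrow> fword"
  where "u + v = FWord (letters u @ letters v)"

instance
  by standard (simp_all add: zero_fword_def plus_fword_def)

end

text \<open>The free associative unital algebra \<open>K\<langle>X\<rangle>\<close>.\<close>

type_synonym 'k free_alg = "fword \<Rightarrow>\<^sub>0 'k"

text \<open>Letters are numbered from 0: the indeterminate \<open>x\<^sub>i\<close> (\<open>i \<ge> 1\<close>) is \<open>X (i - 1)\<close>.\<close>

definition X :: "nat \<Rightarrow> 'k::field free_alg"
  where "X i = Poly_Mapping.single (FWord [i]) 1"

definition scale :: "'k::field \<Rightarrow> 'k free_alg \<Rightarrow> 'k free_alg"
  where "scale c p = Poly_Mapping.map ((*) c) p"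

definition alg_endomorphism :: "('k::field free_alg \<Rightarrow> 'k free_alg) \<Rightarrow> bool"
  where "alg_endomorphism \<phi> \<longleftrightarrow>
    \<phi> 1 = 1 \<and>
    (\<forall>p q. \<phi> (p + q) = \<phi> p + \<phi> q) \<and>
    (\<forall>p q. \<phi> (p * q) = \<phi> p * \<phi> q) \<and>
    (\<forall>c p. \<phi> (scale c p) = scale c (\<phi> p))"

text \<open>
  Closure under negation and scalars follows from closure under multiplication, as the algebra
  is unital.
\<close>

definition two_sided_ideal :: "'k::field free_alg set \<Rightarrow> bool"
  where "two_sided_ideal I \<longleftrightarrow>
    0 \<in> I \<and>
    (\<forall>p\<in>I. \<forall>q\<in>I. p + q \<in> I) \<and>
    (\<forall>p\<in>I. \<forall>a. a * p \<in> I \<and> p * a \<in> I)"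

definition T_ideal :: "'k::field free_alg set \<Rightarrow> bool"
  where "T_ideal I \<longleftrightarrow> two_sided_ideal I \<and> (\<forall>\<phi>. alg_endomorphism \<phi> \<longrightarrow> \<phi> ` I \<subseteq> I)"

definition T_ideal_generated :: "'k::field free_alg set \<Rightarrow> 'k free_alg set"
  where "T_ideal_generated F = T_ideal hull F"

lemma T_ideal_T_ideal_generated: "T_ideal (T_ideal_generated F)"
  unfolding T_ideal_generated_def
  by (rule hull_in) (fastforce simp: T_ideal_def two_sided_ideal_def)

text \<open>
  Left-normed commutators; \<open>lncomm [u\<^sub>1, \<dots>, u\<^sub>n]\<close> is meant for \<open>n \<ge> 2\<close>.
\<close>

definition lncomm :: "'a::ring list \<Rightarrow> 'a"
  where "lncomm us = foldl (\<lambda>u v. u * v - v * u) (hd us) (tl us)"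

definition f_poly :: "'a::ring \<Rightarrow> 'a \<Rightarrow> 'a \<Rightarrow> 'a \<Rightarrow> 'a \<Rightarrow> 'a"
  where "f_poly x1 x2 x3 x4 x5 =
    lncomm [x5, x4] * lncomm [x2, x1, x3] + lncomm [x3, x1, x2] * lncomm [x5, x4]
    + lncomm [x4, x1, x3] * lncomm [x5, x2] + lncomm [x3, x1] * lncomm [x4, x2, x5]
    + lncomm [x4, x3] * lncomm [x5, x1, x2] + lncomm [x5, x3, x4] * lncomm [x2, x1]"

definition S_poly :: "'a::ring \<Rightarrow> 'a \<Rightarrow> 'a \<Rightarrow> 'a \<Rightarrow> 'a \<Rightarrow> 'a"
  where "S_poly x1 x2 x3 x4 x5 =
    lncomm [lncomm [x1, x2] * lncomm [x3, x5], x4]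
    + lncomm [lncomm [x1, x3] * lncomm [x4, x5], x2]
    + lncomm [lncomm [x1, x4] * lncomm [x2, x5], x3]"

definition T_poly :: "'a::ring \<Rightarrow> 'a \<Rightarrow> 'a \<Rightarrow> 'a \<Rightarrow> 'a \<Rightarrow> 'a"
  where "T_poly x1 x2 x3 x4 x5 =
    lncomm [lncomm [x1, x2], x3] * lncomm [x4, x5]
    + lncomm [lncomm [x1, x2], x4] * lncomm [x5, x3]
    + lncomm [lncomm [x1, x2], x5] * lncomm [x3, x4]"

end

theory Submission
  imports Defs
begin

text \<open>
  Both assertions come from linear relations among values of the three polynomials at permutations
  of the variables. With \<open>S\<close> the polynomial \<open>\<SS>\<close>, \<open>T\<close> the polynomial \<open>\<TT>\<close>, and
  \<open>P(i j k l m)\<close> for \<open>P(x\<^sub>i, x\<^sub>j, x\<^sub>k, x\<^sub>l, x\<^sub>m)\<close>, the relations in characteristic 2 are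

    \<open>f(12345) = S(12345) + S(21345) + S(31245) + S(41235) + S(41253) + S(41352) + S(42531)\<close>,

    \<open>S(12345) = f(12345) + f(35412) + f(52413) + T(14235) + T(45123)\<close>,

  proved as \<open>f_poly_eq_S_polys\<close> and \<open>S_poly_eq_f_polys_T_polys\<close> for arbitrary elements of any ring
  with \<open>x + x = 0\<close>. By the Leibniz rule \<open>[uv, w] = [u, w]v + u[v, w]\<close>, all three polynomials are sums
  of products \<open>[x, y, z][u, v]\<close> and \<open>[u, v][x, y, z]\<close>. In characteristic 2 the commutator is
  symmetric, and the Jacobi identity leaves two commutators \<open>[x, y, z]\<close> for each set of three
  variables; hence there are 40 normal forms of such products. The relations above are solutions of
  linear systems over the field with two elements in these coordinates.

  A T-ideal that contains a polynomial contains its values at all tuples of elements, because every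
  assignment of the variables extends to an endomorphism (\<open>alg_endomorphism_subst\<close>). So the first
  relation puts \<open>f\<close> into every T-ideal containing \<open>S\<close>, and the second puts \<open>S\<close> into every
  T-ideal containing \<open>f\<close> and \<open>T\<close>.
\<close>

section \<open>Substitution endomorphisms of the free algebra\<close>

text \<open>
  The value at \<open>p\<close> of the algebra endomorphism with \<open>X i \<mapsto> g i\<close>. The scalar coefficient of a word
  is multiplied in as a constant polynomial.
\<close>

definition subst :: "(nat \<Rightarrow> 'k::field free_alg) \<Rightarrow> 'k free_alg \<Rightarrow> 'k free_alg"
  where "subst g p =
    (\<Sum>w\<in>Poly_Mapping.keys p. Poly_Mapping.single 0 (Poly_Mapping.lookup p w)
      * prod_list (map g (letters w)))"

lemma free_alg_induct [case_names single add]: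
  fixes p :: "'k::field free_alg"
  assumes single: "\<And>w c. P (Poly_Mapping.single w c)"
    and add: "\<And>p q. P p \<Longrightarrow> P q \<Longrightarrow> P (p + q)"
  shows "P p"
proof (induction p rule: update_induct)
  case const
  show ?case
    using single[of 0 0] by simp
next
  case (update p w c)
  then have "Poly_Mapping.update w c p = p + Poly_Mapping.single w c"
    by (intro poly_mapping_eqI)
      (auto simp: lookup_update lookup_add lookup_single in_keys_iff when_def)
  with update.IH show ?case
    by (simp add: add single)
qed

lemma lookup_scale: "Poly_Mapping.lookup (scale c p) w = c * Poly_Mapping.lookup p w"
  by (simp add: scale_def map.rep_eq when_def)

lemma scale_eq_mult: "scale c p = Poly_Mapping.single 0 c * p"
proof (induction p rule: free_alg_induct)
  case (single w a)
  show ?case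
    by (rule poly_mapping_eqI) (simp add: lookup_scale mult_single lookup_single when_def)
next
  case (add p q)
  have "scale c (p + q) = scale c p + scale c q"
    by (rule poly_mapping_eqI) (simp add: lookup_scale lookup_add distrib_left)
  with add show ?case
    by (simp add: distrib_left)
qed

lemma single_0_commute:
  fixes p :: "'k::field free_alg"
  shows "p * Poly_Mapping.single 0 c = Poly_Mapping.single 0 c * p"
  by (induction p rule: free_alg_induct) (simp_all add: mult_single algebra_simps)

lemma letters_add: "letters (u + v) = letters u @ letters v"
  by (simp add: plus_fword_def)

lemma subst_superset:
  assumes "finite A" and "Poly_Mapping.keys p \<subseteq> A"
  shows "subst g p = (\<Sum>w\<in>A. Poly_Mapping.single 0 (Poly_Mapping.lookup p w)
    * prod_list (map g (letters w)))"
  unfolding subst_def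
  by (rule sum.mono_neutral_left) (use assms in \<open>auto simp: in_keys_iff\<close>)

lemma subst_add: "subst g (p + q) = subst g p + subst g q"
proof -
  let ?A = "Poly_Mapping.keys p \<union> Poly_Mapping.keys q"
  have "Poly_Mapping.keys (p + q) \<subseteq> ?A"
    by (rule keys_add)
  then show ?thesis
    by (simp add: subst_superset[where A = ?A] lookup_add single_add distrib_right sum.distrib)
qed

lemma subst_single:
  "subst g (Poly_Mapping.single w c) = Poly_Mapping.single 0 c * prod_list (map g (letters w))"
  by (simp add: subst_superset[where A = "{w}"])

lemma subst_mult: "subst g (p * q) = subst g p * subst g q"
proof (induction p rule: free_alg_induct)
  case (single v a)
  show ?case
  proof (induction q rule: free_alg_induct)
    case (single w b)
    let ?v = "prod_list (map g (letters v))" and ?w = "prod_list (map g (letters w))"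
    have "subst g (Poly_Mapping.single v a * Poly_Mapping.single w b)
      = Poly_Mapping.single 0 a * Poly_Mapping.single 0 b * (?v * ?w)"
      by (simp add: mult_single subst_single letters_add)
    also have "\<dots> = Poly_Mapping.single 0 a * (?v * Poly_Mapping.single 0 b) * ?w"
      by (simp only: single_0_commute[of ?v b] mult.assoc)
    finally show ?case
      by (simp add: subst_single mult.assoc)
  qed (simp add: distrib_left subst_add)
qed (simp add: distrib_right subst_add)

lemma alg_endomorphism_subst: "alg_endomorphism (subst g)"
proof -
  have "subst g (Poly_Mapping.single 0 c) = Poly_Mapping.single 0 c" for c
    by (simp add: subst_single zero_fword_def)
  moreover from this have "subst g 1 = 1"
    by (metis single_one)
  ultimately show ?thesis
    by (simp add: alg_endomorphism_def subst_add subst_mult scale_eq_mult)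
qed

lemma subst_X: "subst g (X i) = g i"
  by (simp add: X_def subst_single)

lemma subst_diff: "subst g (p - q) = subst g p - subst g q"
  by (metis add_diff_cancel diff_add_cancel subst_add)

section \<open>T-ideals and values of multilinear polynomials\<close>

lemma T_ideal_add: "T_ideal I \<Longrightarrow> p \<in> I \<Longrightarrow> q \<in> I \<Longrightarrow> p + q \<in> I"
  by (simp add: T_ideal_def two_sided_ideal_def)

lemma T_ideal_subst: "T_ideal I \<Longrightarrow> p \<in> I \<Longrightarrow> subst g p \<in> I"
  by (meson T_ideal_def alg_endomorphism_subst image_subset_iff)

lemmas subst_hom = subst_add subst_mult subst_diff subst_X

lemma T_ideal_f_poly:
  assumes "T_ideal I" and "f_poly (X 0) (X 1) (X 2) (X 3) (X 4) \<in> I"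
  shows "f_poly a b c d e \<in> I"
  using T_ideal_subst[OF assms, of "nth [a, b, c, d, e]"]
  by (simp add: f_poly_def lncomm_def subst_hom)

lemma T_ideal_S_poly:
  assumes "T_ideal I" and "S_poly (X 0) (X 1) (X 2) (X 3) (X 4) \<in> I"
  shows "S_poly a b c d e \<in> I"
  using T_ideal_subst[OF assms, of "nth [a, b, c, d, e]"]
  by (simp add: S_poly_def lncomm_def subst_hom)

lemma T_ideal_T_poly:
  assumes "T_ideal I" and "T_poly (X 0) (X 1) (X 2) (X 3) (X 4) \<in> I"
  shows "T_poly a b c d e \<in> I"
  using T_ideal_subst[OF assms, of "nth [a, b, c, d, e]"]
  by (simp add: T_poly_def lncomm_def subst_hom)

lemma T_ideal_generated_subset_iff:
  "T_ideal_generated F \<subseteq> T_ideal_generated G \<longleftrightarrow> F \<subseteq> T_ideal_generated G"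
  unfolding T_ideal_generated_def
  by (metis T_ideal_T_ideal_generated T_ideal_generated_def hull_minimal hull_subset subset_trans)

section \<open>Commutator identities in characteristic 2\<close>

lemma lncomm_3: "lncomm [lncomm [x, y], z] = lncomm [x, y, z]"
  by (simp add: lncomm_def)

lemma T_poly_expand:
  "T_poly a b c d e =
    lncomm [a, b, c] * lncomm [d, e] + lncomm [a, b, d] * lncomm [e, c]
    + lncomm [a, b, e] * lncomm [c, d]"
  by (simp add: T_poly_def lncomm_3)

text \<open>
  The identities of this block use \<open>x + x = 0\<close> as their only hypothesis on the ring, so that they
  apply to the free algebra over any field of characteristic 2.
\<close>

context
  assumes two: "\<And>x::'a::ring. x + x = 0"
begin

lemma minus_eq_self: "- (x::'a) = x"
  by (rule minus_unique) (rule two)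

lemma diff_eq_add: "(x::'a) - y = x + y"
  by (metis diff_conv_add_uminus minus_eq_self)

lemma add_cancel2: "(x::'a) + (x + y) = y"
  by (metis add.assoc add_0 two)

lemma lncomm_commute: "lncomm [x, y::'a] = lncomm [y, x]"
  by (simp add: lncomm_def diff_eq_add add.commute)

lemma lncomm_commute3: "lncomm [x, y, z::'a] = lncomm [y, x, z]"
  by (metis lncomm_3 lncomm_commute)

text \<open>
  The Jacobi identity, oriented so as to eliminate the commutators whose third entry is the least
  variable.
\<close>

lemma jacobi: "lncomm [y, z, x::'a] = lncomm [x, y, z] + lncomm [x, z, y]"
  by (simp add: lncomm_def diff_eq_add algebra_simps two add_cancel2)

lemma lncomm_mult: "lncomm [x * y, z::'a] = lncomm [x, z] * y + x * lncomm [y, z]"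
  by (simp add: lncomm_def algebra_simps)

lemma S_poly_expand:
  "S_poly a b c d (e::'a) =
    lncomm [a, b, d] * lncomm [c, e] + lncomm [a, b] * lncomm [c, e, d]
    + (lncomm [a, c, b] * lncomm [d, e] + lncomm [a, c] * lncomm [d, e, b])
    + (lncomm [a, d, c] * lncomm [b, e] + lncomm [a, d] * lncomm [b, e, c])"
  by (simp add: S_poly_def lncomm_mult lncomm_3)

text \<open>
  In the next two proofs the simplifier orders the first two entries of each commutator, applies
  the Jacobi identity to each of the ten sets of three variables, and cancels equal summands in pairs.
\<close>

lemma f_poly_eq_S_polys:
  "f_poly a b c d (e::'a) =
    S_poly a b c d e + S_poly b a c d e + S_poly c a b d e + S_poly d a b c e
    + S_poly d a b e c + S_poly d a c e b + S_poly d b e c a"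
  by (simp add: f_poly_def S_poly_expand
      lncomm_commute lncomm_commute3
      jacobi[of b c a] jacobi[of b d a] jacobi[of b e a] jacobi[of c d a] jacobi[of c e a]
      jacobi[of d e a] jacobi[of c d b] jacobi[of c e b] jacobi[of d e b] jacobi[of d e c]
      distrib_left distrib_right add_ac two add_cancel2)

lemma S_poly_eq_f_polys_T_polys:
  "S_poly a b c d (e::'a) =
    f_poly a b c d e + f_poly c e d a b + f_poly e b d a c
    + T_poly a d b c e + T_poly d e a b c"
  by (simp add: f_poly_def S_poly_expand T_poly_expand
      lncomm_commute lncomm_commute3
      jacobi[of b c a] jacobi[of b d a] jacobi[of b e a] jacobi[of c d a] jacobi[of c e a]
      jacobi[of d e a] jacobi[of c d b] jacobi[of c e b] jacobi[of d e b] jacobi[of d e c]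
      distrib_left distrib_right add_ac two add_cancel2)

end

section \<open>Comparison of the two T-ideals\<close>

lemma free_alg_add_self:
  fixes p :: "'k::field free_alg"
  assumes "CHAR('k) = 2"
  shows "p + p = 0"
proof (rule poly_mapping_eqI)
  fix w
  have "(2::'k) = 0"
    using of_nat_CHAR[where 'a = 'k] assms by simp
  then show "Poly_Mapping.lookup (p + p) w = Poly_Mapping.lookup 0 w"
    by (metis lookup_add lookup_zero mult_2 mult_zero_left)
qed

theorem proposition3p4:
  fixes f S T :: "'k::field free_alg"
  assumes "infinite (UNIV :: 'k set)" and "CHAR('k) = 2"
    and "f = f_poly (X 0) (X 1) (X 2) (X 3) (X 4)"
    and "S = S_poly (X 0) (X 1) (X 2) (X 3) (X 4)"
    and "T = T_poly (X 0) (X 1) (X 2) (X 3) (X 4)"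
  shows "f \<in> T_ideal_generated {S} \<and>
    T_ideal_generated {f, T} = T_ideal_generated {S, T}"
proof -
  note two = free_alg_add_self[OF assms(2)]
  have gen: "F \<subseteq> T_ideal_generated F" for F :: "'k free_alg set"
    unfolding T_ideal_generated_def by (rule hull_subset)
  have f_mem: "f \<in> I" if "T_ideal I" "S \<in> I" for I
    unfolding assms(3) f_poly_eq_S_polys[OF two]
    by (intro T_ideal_add[OF that(1)] T_ideal_S_poly[OF that(1) that(2)[unfolded assms(4)]])
  have S_mem: "S \<in> I" if "T_ideal I" "f \<in> I" "T \<in> I" for I
    unfolding assms(4) S_poly_eq_f_polys_T_polys[OF two]
    by (intro T_ideal_add[OF that(1)] T_ideal_f_poly[OF that(1) that(2)[unfolded assms(3)]]
        T_ideal_T_poly[OF that(1) that(3)[unfolded assms(5)]])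
  have "f \<in> T_ideal_generated {S}"
    using f_mem[OF T_ideal_T_ideal_generated] gen by blast
  moreover have "T_ideal_generated {f, T} \<subseteq> T_ideal_generated {S, T}"
    using f_mem[OF T_ideal_T_ideal_generated] gen
    by (subst T_ideal_generated_subset_iff) blast
  moreover have "T_ideal_generated {S, T} \<subseteq> T_ideal_generated {f, T}"
    using S_mem[OF T_ideal_T_ideal_generated] gen
    by (subst T_ideal_generated_subset_iff) blast
  ultimately show ?thesis
    by blast
qed

end
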